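(* Let $K\ge 2$, $d_k\ge 2$ and $h_k\ge 0$ ($k=1,\dots,K$) be integers, let $N$ be a positive integer, and let $\{\rho_i \mid i=1,2,\dots,N\}$ be a set of states (pure or mixed), written as density matrices, in $\otimes_{k=1}^{K}\mathbb{C}^{d_k}$. Let $\widetilde{\rho_i}=\begin{pmatrix}\rho_i & 0\\ 0 & 0\end{pmatrix}$ be $\rho_i$ viewed as a state in $\otimes_{k=1}^{K}\mathbb{C}^{d_k+h_k}$. Then for each of the following eight kinds of discrimination: perfect via LOCC$_1$ POVMs, perfect via PPT POVMs, perfect via SEP POVMs, perfect via global POVMs, unambiguous via LOCC POVMs, unambiguous via PPT POVMs, unambiguous via SEP POVMs, unambiguous via global POVMs, the following holds: if $\{\rho_i\}_{i=1}^N$ is indistinguishable in that sense in $\otimes_{k=1}^{K}\mathbb{C}^{d_k}$, then $\{\widetilde{\rho_i}\}_{i=1}^N$ is indistinguishable in the same sense in $\otimes_{k=1}^{K}\mathbb{C}^{d_k+h_k}$.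
   Context: A system shared by parties $A^{(1)},\dots,A^{(K)}$ is the Hilbert space $\otimes_{k=1}^K\mathbb{C}^{n_k}$, party $A^{(k)}$ holding $\mathbb{C}^{n_k}$. A state is a density operator (positive semidefinite, trace one). A POVM is a finite family $\{M_j\}_{j=1}^J$ of positive semidefinite operators with $\sum_j M_j=I$. Embedding: $\mathbb{C}^{d_k}$ is the span of the first $d_k$ computational basis vectors of $\mathbb{C}^{d_k+h_k}$, and $\otimes_k\mathbb{C}^{d_k}\subset\otimes_k\mathbb{C}^{d_k+h_k}$ accordingly. The product computational basis of the larger space is ordered so that the basis vectors of $\otimes_k\mathbb{C}^{d_k}$ come first; block matrices are written with respect to this ordering, so $\widetilde\rho$ is $\rho$ extended by zero. Classes of POVMs on $\otimes_k\mathbb{C}^{n_k}$: - Global: any POVM. - SEP: every $M_j$ can be written as a tensor product $\otimes_{s=1}^K A^{(s)}_j$ of local operators. - PPT: every $M_j$ is positive semidefinite after a partial transposition, i.e. for each $j$ there is a nonempty proper subset of the parties (possibly depending on $j$) such that the partial transpose of $M_j$ on these parties is positive semidefinite. - LOCC$_1$: the parties measure once each in the order $A^{(1)},\dots,A^{(K)}$, each choosing a local POVM depending on the previously announced outcomes. That is, the POVM is $\{M_{j_1,\dots,j_K}\}$ with $M_{j_1,\dots,j_K}=\otimes_{s=1}^K A^{(s)}_{j_1,\dots,j_{s-1},j_s}$, where for every $s$ and all previous outcomes $j_1,\dots,j_{s-1}$, the family $\{A^{(s)}_{j_1,\dots,j_{s-1},j}\}_{j}$ ($1\le j\le J_{j_1,\dots,j_{s-1}}$)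 is a POVM on $\mathbb{C}^{n_s}$. - LOCC$_r$: the parties go through $r$ rounds; in each round $A^{(1)},\dots,A^{(K)}$ in order each perform a local measurement (given by Kraus operators $\{E_j\}_j$ on their space, $\sum_j E_j^\dagger E_j=I$) on the current post-measurement state, chosen depending on all previously announced outcomes, and announce the outcome. The POVM elements are $B^\dagger B$, one per complete outcome sequence, where $B=\otimes_s B^{(s)}$ and $B^{(s)}$ is the product, in order of application, of the Kraus operators obtained by $A^{(s)}$. An LOCC POVM is an LOCC$_r$ POVM for some finite $r$. Perfect discrimination: a set $S$ of states is distinguishable via a class of POVMs if there is a POVM $\{M_j\}$ in the class such that for every $j$, $\mathrm{Tr}(M_j\rho)\ne 0$ for at most one $\rho\in S$. Unambiguous discrimination (discrimination allowing an inconclusive result): $S$ is unambiguously distinguishable via a class if there is a POVM $\{M_j\}$ in the class such that for every $\rho\in S$ there is some $j$ with $\mathrm{Tr}(M_j\rho)\neq 0$ and $\mathrm{Tr}(M_j\rho')=0$ for all $\rho'\in S\setminus\{\rho\}$. Indistinguishable means not distinguishable. *)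

theory Defs
  imports "Jordan_Normal_Form.Schur_Decomposition"
begin

subsection \<open>Operators, states and POVMs on a finite-dimensional Hilbert space\<close>

text \<open>The order on \<^typ>\<open>complex\<close> is that of Complex_Order: \<open>0 \<le> z\<close> says that \<open>z\<close> is
  real and nonnegative. Over the complex numbers this forces \<open>M\<close> to be Hermitian.\<close>

definition psd :: "nat \<Rightarrow> complex mat \<Rightarrow> bool" where
  "psd m M \<longleftrightarrow> M \<in> carrier_mat m m \<and> (\<forall>v \<in> carrier_vec m. 0 \<le> (M *\<^sub>v v) \<bullet>c v)"

definition mat_trace :: "complex mat \<Rightarrow> complex" where
  "mat_trace M = sum_list (diag_mat M)"

definition density_operator :: "nat \<Rightarrow> complex mat \<Rightarrow> bool" where
  "density_operator m \<rho> \<longleftrightarrow> psd m \<rho> \<and> mat_trace \<rho> = 1"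

definition mat_list_sum :: "nat \<Rightarrow> complex mat list \<Rightarrow> complex mat" where
  "mat_list_sum m Ms = foldr (+) Ms (0\<^sub>m m m)"

text \<open>A finite family of operators is a list. A class of POVMs is a set of such lists.\<close>

definition povms :: "nat \<Rightarrow> complex mat list set" where
  "povms m = {Ms. (\<forall>M \<in> set Ms. psd m M) \<and> mat_list_sum m Ms = 1\<^sub>m m}"

definition kraus_measurements :: "nat \<Rightarrow> complex mat list set" where
  "kraus_measurements m =
     {Es. set Es \<subseteq> carrier_mat m m \<and>
          mat_list_sum m (map (\<lambda>E. mat_adjoint E * E) Es) = 1\<^sub>m m}"


subsection \<open>Multipartite systems\<close>

text \<open>The parties are \<open>0, \<dots>, K - 1\<close>, party \<open>k\<close> holding a space of dimension \<open>n k\<close>. A product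
  computational basis vector is a multi-index \<open>x\<close> with \<open>x k < n k\<close> for \<open>k < K\<close>. The list \<open>bs\<close> fixes
  the order of the product basis: row and column \<open>i\<close> of a matrix on the whole system belong to
  the basis vector \<open>bs ! i\<close>.\<close>

definition product_basis :: "nat \<Rightarrow> (nat \<Rightarrow> nat) \<Rightarrow> (nat \<Rightarrow> nat) list \<Rightarrow> bool" where
  "product_basis K n bs \<longleftrightarrow> distinct bs \<and> set bs = (\<Pi>\<^sub>E k \<in> {..<K}. {..<n k})"

definition basis_pos :: "(nat \<Rightarrow> nat) list \<Rightarrow> (nat \<Rightarrow> nat) \<Rightarrow> nat" where
  "basis_pos bs = inv_into {..<length bs} ((!) bs)"

definition tensor_op :: "nat \<Rightarrow> (nat \<Rightarrow> nat) list \<Rightarrow> (nat \<Rightarrow> complex mat) \<Rightarrow> complex mat" where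
  "tensor_op K bs A = mat (length bs) (length bs)
     (\<lambda>(i, j). \<Prod>k<K. A k $$ ((bs ! i) k, (bs ! j) k))"

text \<open>The entry of the partial transpose at \<open>(x, y)\<close> is the entry of \<open>M\<close> at the pair obtained by
  exchanging \<open>x k\<close> and \<open>y k\<close> for all parties \<open>k \<in> T\<close>.\<close>

definition partial_transpose ::
    "(nat \<Rightarrow> nat) list \<Rightarrow> nat set \<Rightarrow> complex mat \<Rightarrow> complex mat" where
  "partial_transpose bs T M = mat (length bs) (length bs)
     (\<lambda>(i, j). M $$ (basis_pos bs (override_on (bs ! i) (bs ! j) T),
                     basis_pos bs (override_on (bs ! j) (bs ! i) T)))"

text \<open>If the basis of the larger system is \<open>bs @ cs\<close>, with \<open>bs\<close> the basis of the smaller one and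
  \<open>c = length cs\<close>, then this is the operator seen in the larger system.\<close>

definition zero_extend :: "nat \<Rightarrow> complex mat \<Rightarrow> complex mat" where
  "zero_extend c M =
     four_block_mat M (0\<^sub>m (dim_row M) c) (0\<^sub>m c (dim_col M)) (0\<^sub>m c c)"

lemma product_basis_extend_exists:
  assumes "product_basis K d bs"
  shows "\<exists>cs. product_basis K (\<lambda>k. d k + h k) (bs @ cs)"
proof -
  let ?X = "\<Pi>\<^sub>E k \<in> {..<K}. {..<d k + h k}"
  have "finite ?X"
    by (rule finite_PiE) simp_all
  then obtain cs where cs: "set cs = ?X - set bs" "distinct cs"
    using finite_distinct_list[OF finite_Diff] by metis
  have "set bs \<subseteq> ?X"
    using assms PiE_mono[of "{..<K}" "\<lambda>k. {..<d k}" "\<lambda>k. {..<d k + h k}"]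
    unfolding product_basis_def by simp
  then have "set (bs @ cs) = ?X"
    unfolding set_append cs(1) by (rule Diff_partition)
  moreover have "distinct (bs @ cs)"
    using assms cs unfolding product_basis_def distinct_append by (simp add: Diff_disjoint)
  ultimately show ?thesis
    unfolding product_basis_def by (intro exI conjI)
qed

lemma product_basis_exists: "\<exists>bs. product_basis K n bs"
proof -
  have "finite (\<Pi>\<^sub>E k \<in> {..<K}. {..<n k})"
    by (rule finite_PiE) simp_all
  from finite_distinct_list[OF this] show ?thesis
    unfolding product_basis_def by (simp only: conj_commute)
qed

lemma length_product_basis:
  assumes "product_basis K n bs"
  shows "length bs = (\<Prod>k<K. n k)"
proof -
  have "length bs = card (\<Pi>\<^sub>E k \<in> {..<K}. {..<n k})"
    using assms distinct_card[of bs] unfolding product_basis_def by simp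
  also have "\<dots> = (\<Prod>k<K. card {..<n k})"
    by (rule card_PiE) simp
  finally show ?thesis
    by simp
qed


subsection \<open>Classes of POVMs\<close>

definition sep_povms :: "nat \<Rightarrow> (nat \<Rightarrow> nat) \<Rightarrow> (nat \<Rightarrow> nat) list \<Rightarrow> complex mat list set" where
  "sep_povms K n bs = {Ms \<in> povms (length bs).
     \<forall>M \<in> set Ms. \<exists>A. (\<forall>s<K. A s \<in> carrier_mat (n s) (n s)) \<and> M = tensor_op K bs A}"

definition ppt_povms :: "nat \<Rightarrow> (nat \<Rightarrow> nat) list \<Rightarrow> complex mat list set" where
  "ppt_povms K bs = {Ms \<in> povms (length bs).
     \<forall>M \<in> set Ms. \<exists>T. T \<noteq> {} \<and> T \<subset> {..<K} \<and> psd (length bs) (partial_transpose bs T M)}"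

text \<open>The outcomes announced so far form a list \<open>js\<close>, earliest outcome first. The next measurement
  depends on \<open>js\<close> and has the outcomes \<open>0, \<dots>, J js - 1\<close>.\<close>

definition outcome_seqs :: "(nat list \<Rightarrow> nat) \<Rightarrow> nat \<Rightarrow> nat list set" where
  "outcome_seqs J l = {js. length js = l \<and> (\<forall>t<l. js ! t < J (take t js))}"

text \<open>\<open>A js j\<close> is the operator for outcome \<open>j\<close> of the local POVM measured by party \<open>length js\<close>
  after the outcomes \<open>js\<close>. The list \<open>os\<close> enumerates the complete outcome sequences in any order.\<close>

definition locc1_povms :: "nat \<Rightarrow> (nat \<Rightarrow> nat) \<Rightarrow> (nat \<Rightarrow> nat) list \<Rightarrow> complex mat list set" where
  "locc1_povms K n bs =
     {map (\<lambda>js. tensor_op K bs (\<lambda>s. A (take s js) (js ! s))) os | J A os.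
        (\<forall>s<K. \<forall>js \<in> outcome_seqs J s. map (A js) [0..<J js] \<in> povms (n s)) \<and>
        distinct os \<and> set os = outcome_seqs J K}"

text \<open>In \<open>r\<close> rounds there are \<open>r * K\<close> local measurements. The one in round \<open>q < r\<close> by party \<open>s < K\<close>
  is preceded by \<open>q * K + s\<close> outcomes, and \<open>E js j\<close> is its Kraus operator for outcome \<open>j\<close> when the
  previous outcomes are \<open>js\<close>.\<close>

primrec party_op ::
    "nat \<Rightarrow> (nat \<Rightarrow> nat) \<Rightarrow> (nat list \<Rightarrow> nat \<Rightarrow> complex mat) \<Rightarrow> nat list \<Rightarrow> nat \<Rightarrow> nat \<Rightarrow> complex mat"
  where
  "party_op K n E js s 0 = 1\<^sub>m (n s)"
| "party_op K n E js s (Suc q) =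
     E (take (q * K + s) js) (js ! (q * K + s)) * party_op K n E js s q"

definition locc_r_povms ::
    "nat \<Rightarrow> nat \<Rightarrow> (nat \<Rightarrow> nat) \<Rightarrow> (nat \<Rightarrow> nat) list \<Rightarrow> complex mat list set" where
  "locc_r_povms r K n bs =
     {map (\<lambda>js. let B = tensor_op K bs (\<lambda>s. party_op K n E js s r) in mat_adjoint B * B) os
        | J E os.
        (\<forall>q<r. \<forall>s<K. \<forall>js \<in> outcome_seqs J (q * K + s).
            map (E js) [0..<J js] \<in> kraus_measurements (n s)) \<and>
        distinct os \<and> set os = outcome_seqs J (r * K)}"

definition locc_povms :: "nat \<Rightarrow> (nat \<Rightarrow> nat) \<Rightarrow> (nat \<Rightarrow> nat) list \<Rightarrow> complex mat list set" where
  "locc_povms K n bs = (\<Union>r \<in> {1..}. locc_r_povms r K n bs)"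


subsection \<open>Discrimination\<close>

definition perfectly_distinguishable :: "complex mat list set \<Rightarrow> complex mat set \<Rightarrow> bool" where
  "perfectly_distinguishable C S \<longleftrightarrow>
     (\<exists>Ms \<in> C. \<forall>M \<in> set Ms. \<exists>\<^sub>\<le>\<^sub>1 \<rho>. \<rho> \<in> S \<and> mat_trace (M * \<rho>) \<noteq> 0)"

definition unambiguously_distinguishable :: "complex mat list set \<Rightarrow> complex mat set \<Rightarrow> bool" where
  "unambiguously_distinguishable C S \<longleftrightarrow>
     (\<exists>Ms \<in> C. \<forall>\<rho> \<in> S. \<exists>M \<in> set Ms.
        mat_trace (M * \<rho>) \<noteq> 0 \<and> (\<forall>\<rho>' \<in> S - {\<rho>}. mat_trace (M * \<rho>') = 0))"

end

(* Only the corner of a POVM element on the small space is seen by the states extended by zero, and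
   taking corners preserves positivity, product form, partial transposes and one-way protocols.
   For LOCC with several rounds, the local post-measurement state may leave the small space. But a
   Kraus operator restricted to a space of dimension d factors as X = V A with V an isometry and A a
   d x d matrix (Gram-Schmidt). Each party measures with A instead and absorbs V into its next
   Kraus operator. Since A^* A = X^* X, the POVM elements become the corners of the original ones. *)

theory Submission
  imports Defs
begin

section \<open>Corners of operators\<close>

text \<open>The compression of \<open>M\<close> to the span of the first \<open>m\<close> basis
  vectors, the only part of \<open>M\<close> seen by states supported there.\<close>

definition corner :: "nat \<Rightarrow> complex mat \<Rightarrow> complex mat" where
  "corner m M = mat m m (\<lambda>ij. M $$ ij)"

lemma corner_carrier [simp]: "corner m M \<in> carrier_mat m m"
  by (simp add: corner_def)

lemma dim_corner [simp]: "dim_row (corner m M) = m" "dim_col (corner m M) = m"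
  by (simp_all add: corner_def)

lemma index_corner [simp]: "i < m \<Longrightarrow> j < m \<Longrightarrow> corner m M $$ (i, j) = M $$ (i, j)"
  by (simp add: corner_def)

lemma corner_one: "corner m (1\<^sub>m (m + c)) = 1\<^sub>m m"
  by (rule eq_matI) simp_all

lemma corner_add:
  "A \<in> carrier_mat (m + c) (m + c) \<Longrightarrow> B \<in> carrier_mat (m + c) (m + c) \<Longrightarrow>
    corner m (A + B) = corner m A + corner m B"
  by (rule eq_matI) simp_all

lemma mat_list_sum_Nil [simp]: "mat_list_sum m [] = 0\<^sub>m m m"
  and mat_list_sum_Cons [simp]: "mat_list_sum m (M # Ms) = M + mat_list_sum m Ms"
  by (simp_all add: mat_list_sum_def)

lemma mat_list_sum_carrier [simp]:
  "set Ms \<subseteq> carrier_mat m m \<Longrightarrow> mat_list_sum m Ms \<in> carrier_mat m m"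
  by (induction Ms) simp_all

lemma mat_list_sum_corner:
  "set Ms \<subseteq> carrier_mat (m + c) (m + c) \<Longrightarrow>
    mat_list_sum m (map (corner m) Ms) = corner m (mat_list_sum (m + c) Ms)"
proof (induction Ms)
  case Nil
  show ?case by (rule eq_matI) simp_all
next
  case (Cons M Ms)
  then show ?case by (simp add: corner_add[where c = c])
qed

text \<open>Written as a double sum, the form can be compared between the two spaces by shrinking
  index ranges.\<close>

lemma quadratic_form_sum:
  assumes "M \<in> carrier_mat m m" "v \<in> carrier_vec m"
  shows "(M *\<^sub>v v) \<bullet>c v = (\<Sum>i<m. \<Sum>j<m. M $$ (i, j) * v $ j * cnj (v $ i))"
  using assms
  by (simp add: scalar_prod_def sum_distrib_right lessThan_atLeast0)

text \<open>Pad \<open>v\<close> with zeros to \<open>w\<close>: the form of the corner at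
  \<open>v\<close> is the form of \<open>M\<close> at \<open>w\<close>.\<close>

lemma psd_corner:
  assumes "psd (m + c) M"
  shows "psd m (corner m M)"
  unfolding psd_def
proof (intro conjI ballI)
  fix v :: "complex vec" assume v: "v \<in> carrier_vec m"
  define w where "w = vec (m + c) (\<lambda>i. if i < m then v $ i else 0)"
  have w: "w \<in> carrier_vec (m + c)"
    by (simp add: w_def)
  have M: "M \<in> carrier_mat (m + c) (m + c)"
    using assms by (simp add: psd_def)
  have inner: "(\<Sum>j<m+c. M $$ (i, j) * w $ j * cnj (w $ i)) =
      (\<Sum>j<m. M $$ (i, j) * w $ j * cnj (w $ i))" if "i < m + c" for i
    by (rule sum.mono_neutral_right) (auto simp: w_def)
  have "(M *\<^sub>v w) \<bullet>c w = (\<Sum>i<m+c. \<Sum>j<m. M $$ (i, j) * w $ j * cnj (w $ i))"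
    unfolding quadratic_form_sum[OF M w] by (rule sum.cong) (simp_all add: inner)
  also have "\<dots> = (\<Sum>i<m. \<Sum>j<m. M $$ (i, j) * w $ j * cnj (w $ i))"
    by (rule sum.mono_neutral_right) (auto simp: w_def)
  also have "\<dots> = (corner m M *\<^sub>v v) \<bullet>c v"
    unfolding quadratic_form_sum[OF corner_carrier v] by (simp add: w_def)
  finally show "0 \<le> (corner m M *\<^sub>v v) \<bullet>c v"
    using assms w by (auto simp: psd_def)
qed simp

lemma povms_carrier: "Ms \<in> povms m \<Longrightarrow> M \<in> set Ms \<Longrightarrow> M \<in> carrier_mat m m"
  by (auto simp: povms_def psd_def)

lemma povms_corner:
  assumes "Ms \<in> povms (m + c)"
  shows "map (corner m) Ms \<in> povms m"
proof -
  have "mat_list_sum m (map (corner m) Ms) = corner m (mat_list_sum (m + c) Ms)"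
    using povms_carrier[OF assms] by (intro mat_list_sum_corner) auto
  then show ?thesis
    using assms by (auto simp: povms_def corner_one psd_corner)
qed

lemma mat_trace_sum: "M \<in> carrier_mat m m \<Longrightarrow> mat_trace M = (\<Sum>i<m. M $$ (i, i))"
  by (simp add: mat_trace_def diag_mat_def interv_sum_list_conv_sum_set_nat lessThan_atLeast0)

text \<open>Outcome probabilities depend on the corner alone: in the double sum for the trace, every
  term with an index beyond the small block has a zero entry of the extended state.\<close>

lemma mat_trace_mult_zero_extend:
  assumes M: "M \<in> carrier_mat (m + c) (m + c)" and R: "R \<in> carrier_mat m m"
  shows "mat_trace (M * zero_extend c R) = mat_trace (corner m M * R)"
proof -
  have Z: "zero_extend c R \<in> carrier_mat (m + c) (m + c)"
    using R by (auto simp: zero_extend_def)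
  have ent: "zero_extend c R $$ (i, j) = (if i < m \<and> j < m then R $$ (i, j) else 0)"
    if "i < m + c" "j < m + c" for i j
    using that R by (auto simp: zero_extend_def)
  have "mat_trace (M * zero_extend c R) =
      (\<Sum>i<m+c. \<Sum>j<m+c. M $$ (i, j) * zero_extend c R $$ (j, i))"
    using M Z mat_trace_sum[of "M * zero_extend c R" "m + c"]
    by (simp add: scalar_prod_def lessThan_atLeast0)
  also have "\<dots> = (\<Sum>i<m. \<Sum>j<m+c. M $$ (i, j) * zero_extend c R $$ (j, i))"
    by (rule sum.mono_neutral_right) (auto simp: ent)
  also have "\<dots> = (\<Sum>i<m. \<Sum>j<m. M $$ (i, j) * zero_extend c R $$ (j, i))"
    by (intro sum.cong refl sum.mono_neutral_right) (auto simp: ent)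
  also have "\<dots> = mat_trace (corner m M * R)"
    using R mat_trace_sum[OF mult_carrier_mat[OF corner_carrier[of m M] R]]
    by (simp add: scalar_prod_def lessThan_atLeast0 ent)
  finally show ?thesis .
qed

section \<open>Discrimination seen through corners\<close>

lemma corner_zero_extend: "R \<in> carrier_mat m m \<Longrightarrow> corner m (zero_extend c R) = R"
  by (rule eq_matI) (auto simp: zero_extend_def)

text \<open>Discrimination speaks of sets of states, so distinct states must remain distinct after
  extension.\<close>

lemma inj_on_zero_extend: "S \<subseteq> carrier_mat m m \<Longrightarrow> inj_on (zero_extend c) S"
  by (metis corner_zero_extend inj_onI subsetD)

text \<open>The corners of a successful POVM give the same probabilities on the original states. The
  classes \<open>C'\<close> and \<open>C\<close> are arbitrary, so for each kind of measurement it
  remains to show that corners lead from \<open>C'\<close> into \<open>C\<close>.\<close>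

lemma perfectly_distinguishable_corner:
  assumes S: "S \<subseteq> carrier_mat m m"
    and C: "\<And>Ms. Ms \<in> C' \<Longrightarrow> set Ms \<subseteq> carrier_mat (m + c) (m + c)"
    and CC: "\<And>Ms. Ms \<in> C' \<Longrightarrow> map (corner m) Ms \<in> C"
    and D: "perfectly_distinguishable C' (zero_extend c ` S)"
  shows "perfectly_distinguishable C S"
proof -
  obtain Ms where Ms: "Ms \<in> C'" and
    un: "\<And>M. M \<in> set Ms \<Longrightarrow> \<exists>\<^sub>\<le>\<^sub>1 R. R \<in> zero_extend c ` S \<and> mat_trace (M * R) \<noteq> 0"
    using D by (auto simp: perfectly_distinguishable_def)
  have "\<exists>\<^sub>\<le>\<^sub>1 R. R \<in> S \<and> mat_trace (corner m M * R) \<noteq> 0" if M: "M \<in> set Ms" for M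
  proof (rule Uniq_I)
    fix R R' assume R: "R \<in> S \<and> mat_trace (corner m M * R) \<noteq> 0"
      and R': "R' \<in> S \<and> mat_trace (corner m M * R') \<noteq> 0"
    have "zero_extend c R = zero_extend c R'"
      using mat_trace_mult_zero_extend[of M m c] C[OF Ms] M S R R'
      by (intro Uniq_D[OF un[OF M]]) (auto simp: subset_iff)
    then show "R = R'"
      using R R' inj_on_zero_extend[OF S] by (auto dest: inj_onD)
  qed
  then show ?thesis
    using CC[OF Ms] unfolding perfectly_distinguishable_def by (intro bexI[of _ "map (corner m) Ms"]) auto
qed

lemma unambiguously_distinguishable_corner:
  assumes S: "S \<subseteq> carrier_mat m m"
    and C: "\<And>Ms. Ms \<in> C' \<Longrightarrow> set Ms \<subseteq> carrier_mat (m + c) (m + c)"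
    and CC: "\<And>Ms. Ms \<in> C' \<Longrightarrow> map (corner m) Ms \<in> C"
    and D: "unambiguously_distinguishable C' (zero_extend c ` S)"
  shows "unambiguously_distinguishable C S"
proof -
  obtain Ms where Ms: "Ms \<in> C'" and
    ex: "\<And>R. R \<in> S \<Longrightarrow> \<exists>M\<in>set Ms. mat_trace (M * zero_extend c R) \<noteq> 0 \<and>
      (\<forall>R'\<in>zero_extend c ` S - {zero_extend c R}. mat_trace (M * R') = 0)"
    using D by (auto simp: unambiguously_distinguishable_def)
  have tr: "mat_trace (M * zero_extend c R) = mat_trace (corner m M * R)"
    if "M \<in> set Ms" "R \<in> S" for M R
    using that C[OF Ms] S by (intro mat_trace_mult_zero_extend) auto
  have "\<exists>M\<in>set (map (corner m) Ms). mat_trace (M * R) \<noteq> 0 \<and>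
      (\<forall>R'\<in>S - {R}. mat_trace (M * R') = 0)" if R: "R \<in> S" for R
  proof -
    obtain M where M: "M \<in> set Ms" "mat_trace (M * zero_extend c R) \<noteq> 0"
      and van: "\<And>R'. R' \<in> S \<Longrightarrow> zero_extend c R' \<noteq> zero_extend c R \<Longrightarrow>
        mat_trace (M * zero_extend c R') = 0"
      using ex[OF R] by blast
    \<comment> \<open>By injectivity the extension of \<open>R'\<close> differs from that of
      \<open>R\<close>, so \<open>van\<close> applies to it.\<close>
    have "mat_trace (corner m M * R') = 0" if "R' \<in> S - {R}" for R'
      using that van[of R'] tr[OF M(1), of R'] R inj_on_zero_extend[OF S, of c]
      by (auto dest: inj_onD)
    then show ?thesis
      using M tr[OF M(1) R] by auto
  qed
  then show ?thesis
    using CC[OF Ms] unfolding unambiguously_distinguishable_def by blast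
qed


section \<open>Product operators\<close>

lemma tensor_op_carrier [simp]: "tensor_op K bs A \<in> carrier_mat (length bs) (length bs)"
  and dim_tensor_op [simp]: "dim_row (tensor_op K bs A) = length bs"
    "dim_col (tensor_op K bs A) = length bs"
  by (simp_all add: tensor_op_def)

lemma tensor_op_cong: "(\<And>k. k < K \<Longrightarrow> A k = B k) \<Longrightarrow> tensor_op K bs A = tensor_op K bs B"
  by (simp add: tensor_op_def)

lemma product_basis_nth_less:
  "product_basis K n bs \<Longrightarrow> i < length bs \<Longrightarrow> k < K \<Longrightarrow> (bs ! i) k < n k"
  by (metis PiE_mem lessThan_iff nth_mem product_basis_def)

text \<open>The vectors of \<open>bs\<close> come first and have coordinates below
  \<open>d k\<close>, so the entries of the product at them involve only entries of the local
  corners.\<close>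

lemma corner_tensor_op:
  assumes "product_basis K d bs"
  shows "corner (length bs) (tensor_op K (bs @ cs) A) = tensor_op K bs (\<lambda>k. corner (d k) (A k))"
  by (rule eq_matI)
    (auto simp: tensor_op_def nth_append product_basis_nth_less[OF assms] intro!: prod.cong)

text \<open>Passing from positions to multi-indices makes the distributive law over
  \<open>PiE\<close> available.\<close>

lemma sum_product_basis:
  assumes "product_basis K n bs"
  shows "(\<Sum>l<length bs. f (bs ! l)) = (\<Sum>x\<in>(\<Pi>\<^sub>E k\<in>{..<K}. {..<n k}). f x)"
proof -
  have "distinct bs" "set bs = (\<Pi>\<^sub>E k\<in>{..<K}. {..<n k})"
    using assms by (simp_all add: product_basis_def)
  then show ?thesis
    by (intro sum.reindex_bij_betw bij_betw_nth) simp_all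
qed

lemma tensor_op_mult:
  assumes bs: "product_basis K n bs"
    and A: "\<And>k. k < K \<Longrightarrow> A k \<in> carrier_mat (n k) (n k)"
    and B: "\<And>k. k < K \<Longrightarrow> B k \<in> carrier_mat (n k) (n k)"
  shows "tensor_op K bs A * tensor_op K bs B = tensor_op K bs (\<lambda>k. A k * B k)"
proof (rule eq_matI)
  fix i j assume "i < dim_row (tensor_op K bs (\<lambda>k. A k * B k))"
    and "j < dim_col (tensor_op K bs (\<lambda>k. A k * B k))"
  then have i: "i < length bs" and j: "j < length bs"
    by simp_all
  let ?x = "bs ! i" and ?y = "bs ! j"
  have "(tensor_op K bs A * tensor_op K bs B) $$ (i, j) =
      (\<Sum>l<length bs. \<Prod>k<K. A k $$ (?x k, (bs ! l) k) * B k $$ ((bs ! l) k, ?y k))"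
    using i j by (simp add: tensor_op_def scalar_prod_def prod.distrib lessThan_atLeast0)
  also have "\<dots> = (\<Sum>z\<in>(\<Pi>\<^sub>E k\<in>{..<K}. {..<n k}). \<Prod>k<K. A k $$ (?x k, z k) * B k $$ (z k, ?y k))"
    by (rule sum_product_basis[OF bs])
  \<comment> \<open>Distributivity: choosing a multi-index is choosing one summand in each
    factor.\<close>
  also have "\<dots> = (\<Prod>k<K. \<Sum>l<n k. A k $$ (?x k, l) * B k $$ (l, ?y k))"
    by (rule prod_sum_PiE[symmetric]) simp_all
  also have "\<dots> = (\<Prod>k<K. (A k * B k) $$ (?x k, ?y k))"
  proof (intro prod.cong refl)
    fix k assume "k \<in> {..<K}"
    then have "k < K" by simp
    then show "(\<Sum>l<n k. A k $$ (?x k, l) * B k $$ (l, ?y k)) = (A k * B k) $$ (?x k, ?y k)"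
      using A[of k] B[of k] product_basis_nth_less[OF bs i, of k] product_basis_nth_less[OF bs j, of k]
      by (simp add: scalar_prod_def lessThan_atLeast0)
  qed
  finally show "(tensor_op K bs A * tensor_op K bs B) $$ (i, j) =
      tensor_op K bs (\<lambda>k. A k * B k) $$ (i, j)"
    using i j by (simp add: tensor_op_def)
qed simp_all

section \<open>Adjoints and Gram operators of products\<close>

lemma dim_mat_adjoint [simp]:
  "dim_row (mat_adjoint A) = dim_col A" "dim_col (mat_adjoint A) = dim_row A"
  by (simp_all add: mat_adjoint_def)

lemma mat_adjoint_carrier [simp]: "A \<in> carrier_mat m n \<Longrightarrow> mat_adjoint A \<in> carrier_mat n m"
  by (auto intro: carrier_matI)

lemma index_mat_adjoint [simp]:
  fixes A :: "complex mat"
  shows "i < dim_col A \<Longrightarrow> j < dim_row A \<Longrightarrow> mat_adjoint A $$ (i, j) = cnj (A $$ (j, i))"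
  by (simp add: mat_adjoint_def mat_of_rows_index)

lemma mat_adjoint_mult:
  fixes A B :: "complex mat"
  assumes "A \<in> carrier_mat m n" "B \<in> carrier_mat n p"
  shows "mat_adjoint (A * B) = mat_adjoint B * mat_adjoint A"
  using assms by (intro eq_matI) (auto simp: scalar_prod_def mult.commute intro!: sum.cong)

lemma mat_adjoint_tensor_op:
  assumes bs: "product_basis K n bs"
    and A: "\<And>k. k < K \<Longrightarrow> A k \<in> carrier_mat (n k) (n k)"
  shows "mat_adjoint (tensor_op K bs A) = tensor_op K bs (\<lambda>k. mat_adjoint (A k))"
proof (rule eq_matI)
  fix i j assume "i < dim_row (tensor_op K bs (\<lambda>k. mat_adjoint (A k)))"
    and "j < dim_col (tensor_op K bs (\<lambda>k. mat_adjoint (A k)))"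
  then have i: "i < length bs" and j: "j < length bs"
    by simp_all
  have "cnj (A k $$ ((bs ! j) k, (bs ! i) k)) = mat_adjoint (A k) $$ ((bs ! i) k, (bs ! j) k)"
    if "k < K" for k
    using A[OF that] product_basis_nth_less[OF bs i that] product_basis_nth_less[OF bs j that]
    by simp
  then show "mat_adjoint (tensor_op K bs A) $$ (i, j) =
      tensor_op K bs (\<lambda>k. mat_adjoint (A k)) $$ (i, j)"
    using i j by (simp add: tensor_op_def)
qed simp_all

text \<open>It makes each element \<open>B^* B\<close> of an LOCC POVM a product operator, whose
  corner can be taken party by party.\<close>

lemma tensor_op_gram:
  assumes bs: "product_basis K n bs"
    and A: "\<And>k. k < K \<Longrightarrow> A k \<in> carrier_mat (n k) (n k)"
  shows "mat_adjoint (tensor_op K bs A) * tensor_op K bs A =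
    tensor_op K bs (\<lambda>k. mat_adjoint (A k) * A k)"
  using tensor_op_mult[OF bs, of "\<lambda>k. mat_adjoint (A k)" A] A
  by (simp add: mat_adjoint_tensor_op[OF bs])


section \<open>Separable, PPT and one-way protocols\<close>

lemma sep_povms_corner:
  assumes bs: "product_basis K d bs"
    and Ms: "Ms \<in> sep_povms K n (bs @ cs)"
  shows "map (corner (length bs)) Ms \<in> sep_povms K d bs"
  unfolding sep_povms_def mem_Collect_eq
proof (intro conjI ballI)
  show "map (corner (length bs)) Ms \<in> povms (length bs)"
    using Ms by (intro povms_corner[where c = "length cs"]) (simp add: sep_povms_def)
next
  fix M assume "M \<in> set (map (corner (length bs)) Ms)"
  then obtain A where "M = corner (length bs) (tensor_op K (bs @ cs) A)"
    using Ms by (auto simp: sep_povms_def)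
  then show "\<exists>A. (\<forall>s<K. A s \<in> carrier_mat (d s) (d s)) \<and> M = tensor_op K bs A"
    by (intro exI[of _ "\<lambda>k. corner (d k) (A k)"]) (simp add: corner_tensor_op[OF bs])
qed

section \<open>Partial transposes and corners\<close>

lemma basis_pos_nth: "distinct bs \<Longrightarrow> i < length bs \<Longrightarrow> basis_pos bs (bs ! i) = i"
  unfolding basis_pos_def
  by (rule inv_into_f_f) (auto simp: inj_on_nth)

lemma basis_pos_append:
  assumes "distinct (bs @ cs)" "x \<in> set bs"
  shows "basis_pos (bs @ cs) x = basis_pos bs x" and "basis_pos bs x < length bs"
proof -
  obtain i where i: "i < length bs" "bs ! i = x"
    using assms(2) by (auto simp: in_set_conv_nth)
  have "basis_pos bs x = i"
    using basis_pos_nth[of bs i] assms(1) i by simp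
  moreover have "basis_pos (bs @ cs) x = i"
    using basis_pos_nth[of "bs @ cs" i] assms(1) i by (simp add: nth_append)
  ultimately show "basis_pos (bs @ cs) x = basis_pos bs x" "basis_pos bs x < length bs"
    using i by simp_all
qed

text \<open>Exchanging coordinates between two small basis vectors yields small basis vectors, so
  partial transposition maps the small block to itself.\<close>

lemma override_on_product_basis:
  assumes "product_basis K d bs" "x \<in> set bs" "y \<in> set bs"
  shows "override_on x y T \<in> set bs"
  using assms by (auto simp: product_basis_def override_on_def PiE_iff extensional_def)

text \<open>With this, \<open>psd_corner\<close> applied to the partial transpose gives the PPT
  property of the corner for the same set of parties.\<close>

lemma partial_transpose_corner:
  assumes bs: "product_basis K d bs" and dist: "distinct (bs @ cs)"
  shows "partial_transpose bs T (corner (length bs) M) =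
    corner (length bs) (partial_transpose (bs @ cs) T M)"
proof (rule eq_matI)
  fix i j assume "i < dim_row (corner (length bs) (partial_transpose (bs @ cs) T M))"
    and "j < dim_col (corner (length bs) (partial_transpose (bs @ cs) T M))"
  then have i: "i < length bs" and j: "j < length bs"
    by simp_all
  let ?x = "override_on (bs ! i) (bs ! j) T" and ?y = "override_on (bs ! j) (bs ! i) T"
  have "?x \<in> set bs" "?y \<in> set bs"
    using i j by (auto intro: override_on_product_basis[OF bs])
  then show "partial_transpose bs T (corner (length bs) M) $$ (i, j) =
      corner (length bs) (partial_transpose (bs @ cs) T M) $$ (i, j)"
    using i j by (simp add: partial_transpose_def nth_append basis_pos_append[OF dist])
qed (simp_all add: partial_transpose_def)

lemma ppt_povms_corner:
  assumes bs: "product_basis K d bs" and dist: "distinct (bs @ cs)"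
    and Ms: "Ms \<in> ppt_povms K (bs @ cs)"
  shows "map (corner (length bs)) Ms \<in> ppt_povms K bs"
  unfolding ppt_povms_def mem_Collect_eq
proof (intro conjI ballI)
  show "map (corner (length bs)) Ms \<in> povms (length bs)"
    using Ms by (intro povms_corner[where c = "length cs"]) (simp add: ppt_povms_def)
next
  fix M assume "M \<in> set (map (corner (length bs)) Ms)"
  then obtain M' T where M': "M = corner (length bs) M'" and T: "T \<noteq> {}" "T \<subset> {..<K}"
    and psd: "psd (length bs + length cs) (partial_transpose (bs @ cs) T M')"
    using Ms unfolding ppt_povms_def set_map length_append by blast
  show "\<exists>T. T \<noteq> {} \<and> T \<subset> {..<K} \<and> psd (length bs) (partial_transpose bs T M)"
    using T psd_corner[OF psd] by (auto simp: M' partial_transpose_corner[OF bs dist])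
qed

section \<open>One-way protocols\<close>

lemma take_outcome_seqs:
  "js \<in> outcome_seqs J l \<Longrightarrow> t \<le> l \<Longrightarrow> take t js \<in> outcome_seqs J t"
  by (auto simp: outcome_seqs_def min_def)

lemma locc1_povms_corner:
  assumes bs: "product_basis K d bs" and n: "n = (\<lambda>k. d k + h k)"
    and Ms: "Ms \<in> locc1_povms K n (bs @ cs)"
  shows "map (corner (length bs)) Ms \<in> locc1_povms K d bs"
proof -
  obtain J A os where Ms_eq:
      "Ms = map (\<lambda>js. tensor_op K (bs @ cs) (\<lambda>s. A (take s js) (js ! s))) os"
    and A: "\<And>s js. s < K \<Longrightarrow> js \<in> outcome_seqs J s \<Longrightarrow> map (A js) [0..<J js] \<in> povms (n s)"
    and os: "distinct os" "set os = outcome_seqs J K"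
    using Ms unfolding locc1_povms_def by blast
  \<comment> \<open>The party that measures after the outcomes \<open>js\<close> is
    \<open>length js\<close>, which fixes the size of the local corner. Numbers of outcomes are
    kept.\<close>
  define A' where "A' = (\<lambda>js j. corner (d (length js)) (A js j))"
  have "map (A' js) [0..<J js] \<in> povms (d s)" if "s < K" "js \<in> outcome_seqs J s" for s js
  proof -
    have "length js = s"
      using that(2) by (simp add: outcome_seqs_def)
    then have "map (A' js) [0..<J js] = map (corner (d s)) (map (A js) [0..<J js])"
      by (simp add: A'_def)
    then show ?thesis
      using povms_corner[of _ "d s" "h s"] A[OF that] by (simp only: n)
  qed
  \<comment> \<open>Sequences in \<open>os\<close> have length \<open>K\<close>, so
    \<open>take s js\<close> has length \<open>s\<close> and \<open>A'\<close> cuts to size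
    \<open>d s\<close>.\<close>
  moreover have "map (corner (length bs)) Ms =
      map (\<lambda>js. tensor_op K bs (\<lambda>s. A' (take s js) (js ! s))) os"
    using os(2)
    by (auto simp: Ms_eq corner_tensor_op[OF bs] A'_def outcome_seqs_def min_def
        intro!: tensor_op_cong)
  ultimately show ?thesis
    using os unfolding locc1_povms_def by blast
qed


section \<open>Isometric factorization\<close>

text \<open>Fewer than \<open>n\<close> homogeneous linear conditions leave a nonzero solution: a
  zero row at position \<open>k\<close> makes the square matrix of the system singular.\<close>

lemma orthogonal_vector_exists:
  fixes w :: "nat \<Rightarrow> nat \<Rightarrow> complex"
  assumes "k < n"
  shows "\<exists>z. (\<exists>l<n. z l \<noteq> 0) \<and> (\<forall>i<k. (\<Sum>l<n. cnj (w i l) * z l) = 0)"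
proof -
  let ?row = "\<lambda>i. if i = k then 0\<^sub>v n else vec n (\<lambda>l. cnj (w i l))"
  define M where "M = mat\<^sub>r n n ?row"
  have M: "M \<in> carrier_mat n n"
    by (simp add: M_def)
  have "det M = 0"
    unfolding M_def by (rule det_row_0[OF assms]) auto
  then obtain v where v: "v \<in> carrier_vec n" "v \<noteq> 0\<^sub>v n" "M *\<^sub>v v = 0\<^sub>v n"
    using det_0_iff_vec_prod_zero[OF M] by blast
  have "\<exists>l<n. v $ l \<noteq> 0"
    using v(1,2) by (metis carrier_vecD eq_vecI index_zero_vec)
  moreover have "(\<Sum>l<n. cnj (w i l) * v $ l) = 0" if "i < k" for i
  proof -
    have "(M *\<^sub>v v) $ i = 0"
      using v(3) that assms by simp
    moreover have "row M i = vec n (\<lambda>l. cnj (w i l))"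
      using that assms row_mat_of_row_fun[of i n ?row n] by (simp add: M_def)
    ultimately show ?thesis
      using that assms v(1) M by (simp add: scalar_prod_def lessThan_atLeast0)
  qed
  ultimately show ?thesis
    by (intro exI[of _ "\<lambda>l. v $ l"]) simp
qed

text \<open>Gram-Schmidt for possibly dependent vectors. Whenever a vector adds nothing to the span,
  some orthogonal unit vector is inserted, so that there are always exactly \<open>k\<close> of
  them; \<open>k <= n\<close> leaves room for it.\<close>

lemma orthonormal_spanning_exists:
  fixes x :: "nat \<Rightarrow> nat \<Rightarrow> complex"
  assumes "k \<le> n"
  shows "\<exists>w. (\<forall>i<k. \<forall>j<k. (\<Sum>l<n. cnj (w i l) * w j l) = (if i = j then 1 else 0)) \<and>
    (\<forall>j<k. \<exists>a. \<forall>l<n. x j l = (\<Sum>i<k. w i l * a i))"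
  using assms
proof (induction k)
  case 0
  then show ?case by simp
next
  case (Suc k)
  obtain w where
    orth: "\<forall>i<k. \<forall>j<k. (\<Sum>l<n. cnj (w i l) * w j l) = (if i = j then 1 else 0)"
    and span: "\<forall>j<k. \<exists>a. \<forall>l<n. x j l = (\<Sum>i<k. w i l * a i)"
    using Suc.IH[OF Suc_leD[OF Suc.prems]] by (elim exE conjE) (rule that)
  \<comment> \<open>\<open>c\<close> holds the coefficients of the projection of \<open>x k\<close>
    onto the earlier vectors, and \<open>r\<close> is the residue.\<close>
  define c where "c i = (\<Sum>l<n. cnj (w i l) * x k l)" for i
  define r where "r l = x k l - (\<Sum>i<k. w i l * c i)" for l
  have r_orth: "(\<Sum>l<n. cnj (w i l) * r l) = 0" if "i < k" for i
  proof -
    have "(\<Sum>l<n. cnj (w i l) * r l) = c i - (\<Sum>l<n. \<Sum>j<k. cnj (w i l) * w j l * c j)"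
      by (simp add: r_def c_def algebra_simps sum_subtractf sum_distrib_left)
    also have "(\<Sum>l<n. \<Sum>j<k. cnj (w i l) * w j l * c j) =
        (\<Sum>j<k. (\<Sum>l<n. cnj (w i l) * w j l) * c j)"
      by (subst sum.swap) (simp add: sum_distrib_right)
    also have "\<dots> = (\<Sum>j<k. if i = j then c j else 0)"
      by (rule sum.cong) (simp_all add: orth that)
    also have "\<dots> = c i"
      using that by simp
    finally show ?thesis by simp
  qed
  \<comment> \<open>\<open>z\<close> is the direction of the new vector: the residue itself with
    \<open>t = 1\<close>, or, if the residue vanishes, any nonzero vector orthogonal to the earlier
    ones with \<open>t = 0\<close>.\<close>
  obtain z t where z: "\<exists>l<n. z l \<noteq> 0" "\<And>i. i < k \<Longrightarrow> (\<Sum>l<n. cnj (w i l) * z l) = 0"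
    and rz: "\<And>l. l < n \<Longrightarrow> r l = z l * t"
  proof (cases "\<exists>l<n. r l \<noteq> 0")
    case True
    then show ?thesis
      using that[of r 1] r_orth by simp
  next
    case False
    obtain z where "\<exists>l<n. z l \<noteq> 0" "\<forall>i<k. (\<Sum>l<n. cnj (w i l) * z l) = 0"
      using orthogonal_vector_exists[of k n w] Suc.prems by auto
    with False show ?thesis
      using that[of z 0] by simp
  qed
  define s where "s = sqrt (\<Sum>l<n. (cmod (z l))\<^sup>2)"
  have "(\<Sum>l<n. (cmod (z l))\<^sup>2) > 0"
    using z(1) by (auto intro: sum_pos2)
  then have s: "s > 0" "s\<^sup>2 = (\<Sum>l<n. (cmod (z l))\<^sup>2)"
    by (simp_all add: s_def)
  define u where "u l = z l / s" for l
  have u_orth: "(\<Sum>l<n. cnj (w i l) * u l) = 0" if "i < k" for i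
    using z(2)[OF that] by (simp add: u_def flip: sum_divide_distrib)
  then have u_orth': "(\<Sum>l<n. cnj (u l) * w i l) = 0" if "i < k" for i
    using arg_cong[OF u_orth[OF that], of cnj] by (simp add: mult.commute)
  have "(\<Sum>l<n. cnj (z l) * z l) = complex_of_real (s\<^sup>2)"
    unfolding s(2) by (simp add: complex_norm_square mult.commute del: of_real_power)
  then have u_unit: "(\<Sum>l<n. cnj (u l) * u l) = 1"
    using s(1) by (simp add: u_def power2_eq_square flip: sum_divide_distrib)
  define w' where "w' = w(k := u)"
  have orth': "(\<Sum>l<n. cnj (w' i l) * w' j l) = (if i = j then 1 else 0)" if "i < Suc k" "j < Suc k" for i j
    using that by (auto simp: w'_def less_Suc_eq orth u_orth u_orth' u_unit)
  have span': "\<exists>a. \<forall>l<n. x j l = (\<Sum>i<Suc k. w' i l * a i)" if "j < Suc k" for j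
  proof (cases "j < k")
    case True
    then obtain a where "\<forall>l<n. x j l = (\<Sum>i<k. w i l * a i)"
      using span by blast
    then show ?thesis
      by (intro exI[of _ "a(k := 0)"]) (simp add: w'_def)
  next
    case False
    with that have "j = k" by simp
    \<comment> \<open>From \<open>r = z * t\<close> and \<open>u = z / s\<close>, the residue is
      \<open>u\<close> times \<open>s * t\<close>.\<close>
    moreover have "x k l = (\<Sum>i<k. w i l * c i) + u l * (s * t)" if "l < n" for l
      using rz[OF that] s(1) by (simp add: r_def u_def algebra_simps)
    ultimately show ?thesis
      by (intro exI[of _ "c(k := s * t)"]) (simp add: w'_def)
  qed
  show ?case
    by (intro exI[of _ w'] conjI allI impI orth' span')
qed

definition isometry_of :: "nat \<Rightarrow> nat \<Rightarrow> complex mat \<Rightarrow> bool" where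
  "isometry_of n d V \<longleftrightarrow> V \<in> carrier_mat n d \<and> mat_adjoint V * V = 1\<^sub>m d"

text \<open>The columns of \<open>V\<close> are an orthonormal family whose span contains the
  columns of \<open>X\<close>. In this form the square factor is \<open>mat_adjoint V * X\<close>,
  so only \<open>V\<close> has to be chosen.\<close>

lemma isometric_factorization:
  assumes X: "X \<in> carrier_mat n d" and "d \<le> n"
  shows "\<exists>V. isometry_of n d V \<and> V * (mat_adjoint V * X) = X"
proof -
  obtain w where
    orth: "\<forall>i<d. \<forall>j<d. (\<Sum>l<n. cnj (w i l) * w j l) = (if i = j then 1 else 0)"
    and "\<forall>j<d. \<exists>a. \<forall>l<n. X $$ (l, j) = (\<Sum>i<d. w i l * a i)"
    using orthonormal_spanning_exists[OF assms(2), of "\<lambda>j l. X $$ (l, j)"]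
    by (elim exE conjE) (rule that)
  then obtain a where span: "\<forall>j<d. \<forall>l<n. X $$ (l, j) = (\<Sum>i<d. w i l * a j i)"
    by metis
  define V where "V = mat n d (\<lambda>(l, i). w i l)"
  define A where "A = mat d d (\<lambda>(i, j). a j i)"
  have V: "V \<in> carrier_mat n d" and A: "A \<in> carrier_mat d d"
    by (simp_all add: V_def A_def)
  have iso: "mat_adjoint V * V = 1\<^sub>m d"
    using V by (intro eq_matI) (auto simp: scalar_prod_def V_def orth simp flip: lessThan_atLeast0)
  have XA: "X = V * A"
    using X by (intro eq_matI) (auto simp: scalar_prod_def V_def A_def span simp flip: lessThan_atLeast0)
  have "mat_adjoint V * X = (mat_adjoint V * V) * A"
    unfolding XA by (rule assoc_mult_mat[symmetric, OF mat_adjoint_carrier[OF V] V A])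
  then have "mat_adjoint V * X = A"
    using A by (simp add: iso)
  then show ?thesis
    using V iso XA by (auto simp: isometry_of_def)
qed

text \<open>A choice depending on \<open>X\<close> alone, so that the isometries of a protocol
  become a recursive function of the outcomes.\<close>

definition isometric_part :: "complex mat \<Rightarrow> complex mat" where
  "isometric_part X =
    (SOME V. isometry_of (dim_row X) (dim_col X) V \<and> V * (mat_adjoint V * X) = X)"

lemma isometric_part:
  assumes "X \<in> carrier_mat n d" and "d \<le> n"
  shows "isometry_of n d (isometric_part X)"
    and "isometric_part X * (mat_adjoint (isometric_part X) * X) = X"
proof -
  have "dim_row X = n" "dim_col X = d"
    using assms(1) by auto
  then show "isometry_of n d (isometric_part X)"
    "isometric_part X * (mat_adjoint (isometric_part X) * X) = X"
    using someI_ex[OF isometric_factorization[OF assms]] by (simp_all add: isometric_part_def)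
qed

text \<open>\<open>V^* V = 1\<close> cancels in the middle. Hence discarding an isometry on the left
  changes neither completeness sums nor POVM elements.\<close>

lemma isometry_gram:
  assumes V: "isometry_of n d V" and A: "A \<in> carrier_mat d p"
  shows "mat_adjoint (V * A) * (V * A) = mat_adjoint A * A"
proof -
  have V': "V \<in> carrier_mat n d" and VV: "mat_adjoint V * V = 1\<^sub>m d"
    using V by (simp_all add: isometry_of_def)
  have "mat_adjoint (V * A) * (V * A) = mat_adjoint A * (mat_adjoint V * (V * A))"
    using V' A by (simp add: mat_adjoint_mult[OF V' A] assoc_mult_mat[of _ p d _ n _ p])
  also have "mat_adjoint V * (V * A) = A"
    using V' A by (simp add: VV assoc_mult_mat[of _ d n _ d _ p, symmetric])
  finally show ?thesis .
qed

section \<open>The inclusion of the small local space\<close>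

definition embedding :: "nat \<Rightarrow> nat \<Rightarrow> complex mat" where
  "embedding n d = mat n d (\<lambda>(i, j). if i = j then 1 else 0)"

lemma embedding_carrier [simp]: "embedding n d \<in> carrier_mat n d"
  by (simp add: embedding_def)

lemma mult_embedding:
  assumes "X \<in> carrier_mat p n" "d \<le> n"
  shows "X * embedding n d = mat p d (\<lambda>ij. X $$ ij)"
  using assms by (intro eq_matI)
    (auto simp: embedding_def scalar_prod_def if_distrib[of "(*) _"] cong: if_cong)

lemma isometry_embedding: "d \<le> n \<Longrightarrow> isometry_of n d (embedding n d)"
  unfolding isometry_of_def
  by (subst mult_embedding[where p = d]) (auto simp: embedding_def)

text \<open>Entry (i, j) of \<open>P^* P\<close> is an inner product of columns of \<open>P\<close>,
  and the corner uses only the first \<open>d\<close> columns.\<close>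

lemma corner_gram:
  assumes P: "P \<in> carrier_mat n n" and "d \<le> n"
  shows "corner d (mat_adjoint P * P) = mat_adjoint (P * embedding n d) * (P * embedding n d)"
  unfolding mult_embedding[OF assms]
  using assms by (intro eq_matI) (auto simp: scalar_prod_def)


section \<open>Compressing LOCC protocols\<close>

text \<open>A Kraus operator may map the small local space out of itself, so its corner is in general not
  a Kraus operator of a measurement. Instead the isometry \<open>party_iso K d n E js s q\<close>, which depends
  on the previous outcomes, maps the small space of party \<open>s\<close> onto a space that contains all
  its possible local states after \<open>q\<close> rounds.\<close>

primrec party_iso :: "nat \<Rightarrow> (nat \<Rightarrow> nat) \<Rightarrow> (nat \<Rightarrow> nat) \<Rightarrow> (nat list \<Rightarrow> nat \<Rightarrow> complex mat) \<Rightarrow>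
    nat list \<Rightarrow> nat \<Rightarrow> nat \<Rightarrow> complex mat" where
  "party_iso K d n E js s 0 = embedding (n s) (d s)"
| "party_iso K d n E js s (Suc q) =
    isometric_part (E (take (q * K + s) js) (js ! (q * K + s)) * party_iso K d n E js s q)"

text \<open>After \<open>q * K + s\<close> outcomes party \<open>s\<close> acts in round
  \<open>q\<close>, hence \<open>mod\<close> and \<open>div\<close>. \<open>X\<close> is the
  original Kraus operator on the subspace currently occupied. Its square factor is measured, and its
  isometric part goes into the next \<open>party_iso\<close>.\<close>

definition compressed_kraus :: "nat \<Rightarrow> (nat \<Rightarrow> nat) \<Rightarrow> (nat \<Rightarrow> nat) \<Rightarrow>
    (nat list \<Rightarrow> nat \<Rightarrow> complex mat) \<Rightarrow> nat list \<Rightarrow> nat \<Rightarrow> complex mat" where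
  "compressed_kraus K d n E js j =
    (let X = E js j * party_iso K d n E js (length js mod K) (length js div K)
     in mat_adjoint (isometric_part X) * X)"

text \<open>After \<open>q\<close> rounds the isometry of party \<open>s\<close> depends only on
  outcomes before position \<open>q * K + s\<close>. This matches isometries computed from a
  truncated and from a complete history.\<close>

lemma party_iso_take:
  "K > 0 \<Longrightarrow> q * K + s \<le> m \<Longrightarrow> party_iso K d n E (take m js) s q = party_iso K d n E js s q"
proof (induction q)
  case (Suc q)
  then have "q * K + s < m" by simp
  with Suc show ?case by (simp add: min_def)
qed simp

text \<open>For a Kraus family and an isometry \<open>V\<close> the right side is
  \<open>V^* V = 1\<close>, which is the completeness of the restricted family.\<close>

lemma mat_list_sum_gram_mult:
  assumes "set Es \<subseteq> carrier_mat n n" and V: "V \<in> carrier_mat n d"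
  shows "mat_list_sum d (map (\<lambda>E. mat_adjoint (E * V) * (E * V)) Es) =
    mat_adjoint V * (mat_list_sum n (map (\<lambda>E. mat_adjoint E * E) Es) * V)"
  using assms(1)
proof (induction Es)
  case Nil
  have "mat_adjoint V * 0\<^sub>m n d = 0\<^sub>m d d"
    using V by (intro right_mult_zero_mat) auto
  then show ?case
    using V by simp
next
  case (Cons E Es)
  let ?G = "mat_list_sum n (map (\<lambda>E. mat_adjoint E * E) Es)"
  have E: "E \<in> carrier_mat n n" and G: "?G \<in> carrier_mat n n"
    using Cons.prems
    by (auto intro!: mat_list_sum_carrier mult_carrier_mat[OF mat_adjoint_carrier])
  have "mat_adjoint (E * V) * (E * V) = mat_adjoint V * (mat_adjoint E * E * V)"
    using E V by (simp add: mat_adjoint_mult[OF E V] assoc_mult_mat[of _ d n _ n _ d]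
        assoc_mult_mat[of _ n n _ n _ d])
  moreover have "(mat_adjoint E * E + ?G) * V = mat_adjoint E * E * V + ?G * V"
    using E G V by (intro add_mult_distrib_mat) auto
  moreover have "mat_adjoint V * (mat_adjoint E * E * V + ?G * V) =
      mat_adjoint V * (mat_adjoint E * E * V) + mat_adjoint V * (?G * V)"
    using E G V by (intro mult_add_distrib_mat) (auto intro!: mult_carrier_mat)
  ultimately show ?case
    using Cons by simp
qed

section \<open>Compression of one fixed protocol\<close>

context
  fixes r K :: nat and d n :: "nat \<Rightarrow> nat" and J :: "nat list \<Rightarrow> nat"
    and E :: "nat list \<Rightarrow> nat \<Rightarrow> complex mat"
  assumes K: "K > 0" and dn: "\<And>s. d s \<le> n s"
    and kraus: "\<forall>q<r. \<forall>s<K. \<forall>js\<in>outcome_seqs J (q * K + s).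
      map (E js) [0..<J js] \<in> kraus_measurements (n s)"
begin

lemma kraus_carrier:
  assumes "q < r" "s < K" "js \<in> outcome_seqs J l" "q * K + s < l"
  shows "E (take (q * K + s) js) (js ! (q * K + s)) \<in> carrier_mat (n s) (n s)"
proof -
  let ?t = "q * K + s"
  have "take ?t js \<in> outcome_seqs J ?t" "js ! ?t < J (take ?t js)"
    using assms(3,4) take_outcome_seqs[of js J l ?t] by (auto simp: outcome_seqs_def)
  then show ?thesis
    using kraus assms(1,2) by (fastforce simp: kraus_measurements_def)
qed

text \<open>For \<open>q > 0\<close> the last outcome used is at position
  \<open>(q - 1) * K + s\<close>, which must lie below \<open>l\<close>. The bound states this
  without subtraction and admits \<open>q = 0\<close>.\<close>

lemma party_iso_isometry:
  assumes "js \<in> outcome_seqs J l" "s < K" "q \<le> r" "q * K + s < l + K"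
  shows "isometry_of (n s) (d s) (party_iso K d n E js s q)"
  using assms(3,4)
proof (induction q)
  case 0
  then show ?case by (simp add: isometry_embedding dn)
next
  case (Suc q)
  then have "E (take (q * K + s) js) (js ! (q * K + s)) \<in> carrier_mat (n s) (n s)"
    using assms(1,2) by (intro kraus_carrier[where l = l]) auto
  with Suc show ?case
    by (auto simp: isometry_of_def intro!: isometric_part(1)[unfolded isometry_of_def] dn)
qed

text \<open>The compressed operators have the Gram operators of the restricted ones,
  \<open>E js j * ?V\<close>, and these sum to the identity because \<open>?V\<close> is an
  isometry.\<close>

lemma compressed_kraus_measurement:
  assumes q: "q < r" and s: "s < K" and js: "js \<in> outcome_seqs J (q * K + s)"
  shows "map (compressed_kraus K d n E js) [0..<J js] \<in> kraus_measurements (d s)"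
proof -
  let ?V = "party_iso K d n E js s q"
  let ?A = "compressed_kraus K d n E js"
  let ?Es = "map (E js) [0..<J js]"
  have V: "isometry_of (n s) (d s) ?V"
    using q s by (intro party_iso_isometry[OF js]) auto
  then have V': "?V \<in> carrier_mat (n s) (d s)" and VV: "mat_adjoint ?V * ?V = 1\<^sub>m (d s)"
    by (simp_all add: isometry_of_def)
  have Es: "set ?Es \<subseteq> carrier_mat (n s) (n s)"
    and sum1: "mat_list_sum (n s) (map (\<lambda>E. mat_adjoint E * E) ?Es) = 1\<^sub>m (n s)"
    using kraus q s js by (simp_all add: kraus_measurements_def)
  have "length js = q * K + s"
    using js by (simp add: outcome_seqs_def)
  then have A: "?A j = mat_adjoint (isometric_part (E js j * ?V)) * (E js j * ?V)" for j
    using s by (simp add: compressed_kraus_def Let_def)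
  have *: "?A j \<in> carrier_mat (d s) (d s)"
    "mat_adjoint (?A j) * ?A j = mat_adjoint (E js j * ?V) * (E js j * ?V)" if "j < J js" for j
  proof -
    have X: "E js j * ?V \<in> carrier_mat (n s) (d s)"
      using Es that V' by (intro mult_carrier_mat[of _ _ "n s"]) auto
    note ip = isometric_part[OF X dn]
    show "?A j \<in> carrier_mat (d s) (d s)"
      unfolding A using ip(1)
      by (intro mult_carrier_mat[OF mat_adjoint_carrier X]) (simp add: isometry_of_def)
    from isometry_gram[OF ip(1) this] ip(2)
    show "mat_adjoint (?A j) * ?A j = mat_adjoint (E js j * ?V) * (E js j * ?V)"
      by (simp add: A)
  qed
  have "map (\<lambda>E. mat_adjoint E * E) (map ?A [0..<J js]) =
      map (\<lambda>E. mat_adjoint (E * ?V) * (E * ?V)) ?Es"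
    using *(2) by simp
  then have "mat_list_sum (d s) (map (\<lambda>E. mat_adjoint E * E) (map ?A [0..<J js])) = 1\<^sub>m (d s)"
    using V' by (simp only: mat_list_sum_gram_mult[OF Es V'] sum1) (simp add: VV)
  then show ?thesis
    using *(1) by (auto simp: kraus_measurements_def)
qed

text \<open>The invariant of the simulation: on the small space the accumulated operator of a party
  is its accumulated compressed operator followed by an isometry. The dimensions are carried along
  for the associativity steps.\<close>

lemma party_op_compressed:
  assumes js: "js \<in> outcome_seqs J (r * K)" and s: "s < K" and "q \<le> r"
  shows "party_op K n E js s q \<in> carrier_mat (n s) (n s) \<and>
    party_op K d (compressed_kraus K d n E) js s q \<in> carrier_mat (d s) (d s) \<and>
    party_op K n E js s q * embedding (n s) (d s) =
      party_iso K d n E js s q * party_op K d (compressed_kraus K d n E) js s q"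
  using assms(3)
proof (induction q)
  case 0
  have "embedding (n s) (d s) \<in> carrier_mat (n s) (d s)"
    by simp
  then have "1\<^sub>m (n s) * embedding (n s) (d s) = embedding (n s) (d s) * 1\<^sub>m (d s)"
    by (simp only: left_mult_one_mat right_mult_one_mat)
  then show ?case
    by simp
next
  case (Suc q)
  let ?t = "q * K + s"
  let ?E = "E (take ?t js) (js ! ?t)"
  let ?A = "compressed_kraus K d n E (take ?t js) (js ! ?t)"
  let ?V = "party_iso K d n E js s q" and ?W = "party_iso K d n E js s (Suc q)"
  let ?P = "party_op K n E js s q" and ?Q = "party_op K d (compressed_kraus K d n E) js s q"
  let ?I = "embedding (n s) (d s)"
  have "Suc q * K \<le> r * K"
    using Suc.prems by (rule mult_le_mono1)
  then have t: "?t < r * K"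
    using s by simp
  have len: "length (take ?t js) = ?t"
    using js t by (simp add: outcome_seqs_def)
  have E: "?E \<in> carrier_mat (n s) (n s)"
    using Suc.prems js s t by (intro kraus_carrier) auto
  have "isometry_of (n s) (d s) ?V"
    using Suc.prems s t by (intro party_iso_isometry[OF js]) auto
  then have V: "?V \<in> carrier_mat (n s) (d s)"
    by (simp add: isometry_of_def)
  have X: "?E * ?V \<in> carrier_mat (n s) (d s)"
    using E V by simp
  have W: "?W \<in> carrier_mat (n s) (d s)"
    using isometric_part(1)[OF X dn] by (simp add: isometry_of_def)
  \<comment> \<open>\<open>?A\<close> uses the isometry of the truncated history and
    \<open>?W\<close> that of \<open>js\<close>; \<open>party_iso_take\<close> identifies
    them.\<close>
  have A_eq: "?A = mat_adjoint ?W * (?E * ?V)"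
    using s K len by (simp add: compressed_kraus_def Let_def party_iso_take)
  have A: "?A \<in> carrier_mat (d s) (d s)"
    unfolding A_eq using W by (intro mult_carrier_mat[OF mat_adjoint_carrier X])
  have WA: "?W * ?A = ?E * ?V"
    unfolding A_eq using isometric_part(2)[OF X dn] by simp
  have P: "?P \<in> carrier_mat (n s) (n s)" and Q: "?Q \<in> carrier_mat (d s) (d s)"
    and IH: "?P * ?I = ?V * ?Q"
    using Suc by simp_all
  \<comment> \<open>The old isometry is absorbed into the Kraus operator and a new one is split off
    on the left.\<close>
  have "?E * ?P * ?I = ?E * (?V * ?Q)"
    using assoc_mult_mat[OF E P embedding_carrier] by (simp add: IH)
  also have "\<dots> = ?W * ?A * ?Q"
    unfolding WA by (rule assoc_mult_mat[symmetric, OF E V Q])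
  also have "\<dots> = ?W * (?A * ?Q)"
    by (rule assoc_mult_mat[OF W A Q])
  finally show ?case
    using E P A Q by (simp del: party_iso.simps)
qed

text \<open>Locally, the corner of \<open>P^* P\<close> is the Gram operator of \<open>P\<close> on
  the small space, where \<open>P\<close> is an isometry times \<open>Q\<close>; the isometry
  cancels.\<close>

lemma corner_locc_element:
  assumes bs: "product_basis K d bs" and large: "product_basis K n (bs @ cs)"
    and js: "js \<in> outcome_seqs J (r * K)"
  defines "B \<equiv> tensor_op K (bs @ cs) (\<lambda>s. party_op K n E js s r)"
    and "B' \<equiv> tensor_op K bs (\<lambda>s. party_op K d (compressed_kraus K d n E) js s r)"
  shows "corner (length bs) (mat_adjoint B * B) = mat_adjoint B' * B'"
proof -
  let ?P = "\<lambda>s. party_op K n E js s r"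
  let ?Q = "\<lambda>s. party_op K d (compressed_kraus K d n E) js s r"
  have P: "?P s \<in> carrier_mat (n s) (n s)" and Q: "?Q s \<in> carrier_mat (d s) (d s)"
    and PQ: "?P s * embedding (n s) (d s) = party_iso K d n E js s r * ?Q s" if "s < K" for s
    using party_op_compressed[OF js that order_refl] by simp_all
  have "corner (d s) (mat_adjoint (?P s) * ?P s) = mat_adjoint (?Q s) * ?Q s" if "s < K" for s
  proof -
    have "isometry_of (n s) (d s) (party_iso K d n E js s r)"
      using that by (intro party_iso_isometry[OF js]) auto
    then show ?thesis
      unfolding corner_gram[OF P[OF that] dn] PQ[OF that] by (rule isometry_gram) (rule Q[OF that])
  qed
  then show ?thesis
    unfolding B_def B'_def
    by (simp add: tensor_op_gram[OF large P] tensor_op_gram[OF bs Q] corner_tensor_op[OF bs]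
        cong: tensor_op_cong)
qed

end

lemma locc_povms_corner:
  assumes K: "K > 0" and dn: "\<And>s. d s \<le> n s"
    and bs: "product_basis K d bs" and large: "product_basis K n (bs @ cs)"
    and Ms: "Ms \<in> locc_povms K n (bs @ cs)"
  shows "map (corner (length bs)) Ms \<in> locc_povms K d bs"
proof -
  obtain r J E os where r: "r \<ge> 1" and Ms_eq: "Ms = map (\<lambda>js.
        let B = tensor_op K (bs @ cs) (\<lambda>s. party_op K n E js s r) in mat_adjoint B * B) os"
    and kraus: "\<forall>q<r. \<forall>s<K. \<forall>js\<in>outcome_seqs J (q * K + s).
      map (E js) [0..<J js] \<in> kraus_measurements (n s)"
    and os: "distinct os" "set os = outcome_seqs J (r * K)"
    using Ms unfolding locc_povms_def locc_r_povms_def by blast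
  let ?E = "compressed_kraus K d n E"
  have "map (corner (length bs)) Ms = map (\<lambda>js.
      let B = tensor_op K bs (\<lambda>s. party_op K d ?E js s r) in mat_adjoint B * B) os"
    using os(2) corner_locc_element[OF K dn kraus bs large]
    by (simp add: Ms_eq Let_def)
  moreover have "\<forall>q<r. \<forall>s<K. \<forall>js\<in>outcome_seqs J (q * K + s).
      map (?E js) [0..<J js] \<in> kraus_measurements (d s)"
    using compressed_kraus_measurement[OF K dn kraus] by blast
  ultimately have "map (corner (length bs)) Ms \<in> locc_r_povms r K d bs"
    using os unfolding locc_r_povms_def by blast
  then show ?thesis
    using r by (auto simp: locc_povms_def)
qed

text \<open>LOCC classes are not defined as subsets of \<open>povms\<close>, so the dimensions come
  from the product form.\<close>

lemma locc_povms_carrier: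
  "Ms \<in> locc_povms K n bs \<Longrightarrow> set Ms \<subseteq> carrier_mat (length bs) (length bs)"
  by (auto simp: locc_povms_def locc_r_povms_def Let_def
      intro!: mult_carrier_mat[OF mat_adjoint_carrier[OF tensor_op_carrier]])

lemma locc1_povms_carrier:
  "Ms \<in> locc1_povms K n bs \<Longrightarrow> set Ms \<subseteq> carrier_mat (length bs) (length bs)"
  by (auto simp: locc1_povms_def)

theorem theorem1:
  fixes K N :: nat and d h n :: "nat \<Rightarrow> nat"
    and bs cs :: "(nat \<Rightarrow> nat) list"
    and \<rho> :: "nat \<Rightarrow> complex mat" and S S' :: "complex mat set"
  assumes "K \<ge> 2" and "\<forall>k<K. d k \<ge> 2" and "N \<ge> 1"
    and n: "n = (\<lambda>k. d k + h k)"
    and small_basis: "product_basis K d bs"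
    and large_basis: "product_basis K n (bs @ cs)"
    and states: "\<forall>i \<in> {1..N}. density_operator (length bs) (\<rho> i)"
    and S: "S = {\<rho> i | i. i \<in> {1..N}}"
    and S': "S' = {zero_extend (length cs) (\<rho> i) | i. i \<in> {1..N}}"
  shows
    "(\<not> perfectly_distinguishable (locc1_povms K d bs) S \<longrightarrow>
      \<not> perfectly_distinguishable (locc1_povms K n (bs @ cs)) S') \<and>
     (\<not> perfectly_distinguishable (ppt_povms K bs) S \<longrightarrow>
      \<not> perfectly_distinguishable (ppt_povms K (bs @ cs)) S') \<and>
     (\<not> perfectly_distinguishable (sep_povms K d bs) S \<longrightarrow>
      \<not> perfectly_distinguishable (sep_povms K n (bs @ cs)) S') \<and>
     (\<not> perfectly_distinguishable (povms (length bs)) S \<longrightarrow>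
      \<not> perfectly_distinguishable (povms (length (bs @ cs))) S') \<and>
     (\<not> unambiguously_distinguishable (locc_povms K d bs) S \<longrightarrow>
      \<not> unambiguously_distinguishable (locc_povms K n (bs @ cs)) S') \<and>
     (\<not> unambiguously_distinguishable (ppt_povms K bs) S \<longrightarrow>
      \<not> unambiguously_distinguishable (ppt_povms K (bs @ cs)) S') \<and>
     (\<not> unambiguously_distinguishable (sep_povms K d bs) S \<longrightarrow>
      \<not> unambiguously_distinguishable (sep_povms K n (bs @ cs)) S') \<and>
     (\<not> unambiguously_distinguishable (povms (length bs)) S \<longrightarrow>
      \<not> unambiguously_distinguishable (povms (length (bs @ cs))) S')"
proof -
  let ?m = "length bs" and ?c = "length cs"
  have SC: "S \<subseteq> carrier_mat ?m ?m"
    using states by (auto simp: S density_operator_def psd_def)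
  have S'_eq: "S' = zero_extend ?c ` S"
    by (auto simp: S S')
  have dist: "distinct (bs @ cs)"
    using large_basis by (simp add: product_basis_def)
  have K: "K > 0" and dn: "\<And>s. d s \<le> n s"
    using assms(1) by (simp_all add: n)
  have povms: "set Ms \<subseteq> carrier_mat (?m + ?c) (?m + ?c)" if "Ms \<in> povms (?m + ?c)" for Ms
    using povms_carrier[OF that] by auto
  have sep: "set Ms \<subseteq> carrier_mat (?m + ?c) (?m + ?c)" if "Ms \<in> sep_povms K n (bs @ cs)" for Ms
    using that by (intro povms) (simp add: sep_povms_def)
  have ppt: "set Ms \<subseteq> carrier_mat (?m + ?c) (?m + ?c)" if "Ms \<in> ppt_povms K (bs @ cs)" for Ms
    using that by (intro povms) (simp add: ppt_povms_def)
  have locc: "set Ms \<subseteq> carrier_mat (?m + ?c) (?m + ?c)" if "Ms \<in> locc_povms K n (bs @ cs)" for Ms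
    using locc_povms_carrier[OF that] by simp
  have locc1: "set Ms \<subseteq> carrier_mat (?m + ?c) (?m + ?c)" if "Ms \<in> locc1_povms K n (bs @ cs)" for Ms
    using locc1_povms_carrier[OF that] by simp
  note carriers = povms sep ppt locc locc1
    and corners = povms_corner sep_povms_corner[OF small_basis]
      ppt_povms_corner[OF small_basis dist] locc_povms_corner[OF K dn small_basis large_basis]
      locc1_povms_corner[OF small_basis n]
  \<comment> \<open>The rotation puts distinguishability in the large space first. Eliminating it
    fixes the class \<open>C'\<close>, and then dimensions and closure under corners remain.\<close>
  note transfer = perfectly_distinguishable_corner[OF SC, rotated 2]
      unambiguously_distinguishable_corner[OF SC, rotated 2]
  show ?thesis
    unfolding S'_eq length_append
    by (intro conjI impI; erule contrapos_nn; erule transfer; erule carriers corners)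
qed

end
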